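(* Let $E\subset\mathbb{C}$ be a regular compact set and $(a_n)_{n=0}^\infty$ a pseudo Leja sequence in $E$ of Edrei growth $(C_n)_{n=1}^\infty$. Put $\sigma_n:=\min_{j\in\{0,\dots,n-1\}}|a_n-a_j|$ for $n\ge1$. Then $$\lim_{n\to\infty}\sqrt[n]{\sigma_n}=1.$$ Moreover, for every $n\ge1$, $$\sigma_n\ge\frac{\log(1+1/C_n)}{M_n}\ge\frac{1}{2\,C_n\,M_n},$$ where $M_n=M_n(E)$ is the $n$-th Markov constant of $E$.
   Context: For compact $E\subset\mathbb{C}$, $\widehat E=\{z\in\mathbb{C}:|p(z)|\le\max_{w\in E}|p(w)|\text{ for every complex polynomial }p\}$. $E$ is regular if the Green function of $D_\infty=\mathbb{C}\setminus\widehat E$ with pole at infinity exists: a function harmonic and positive in $D_\infty$, tending to $0$ at $\partial D_\infty$, whose difference with $\log|z|$ tends to a finite number as $z\to\infty$. $\|\cdot\|_E$ is the sup norm on $E$. Pseudo Leja sequence: let $(C_n)_{n=1}^\infty$ be real numbers with $\lim_{n\to\infty}C_n^{1/n}=1$. A sequence of points $a_n\in E$, $n=0,1,2,\dots$, is a pseudo Leja sequence in $E$ of Edrei growth $(C_n)$ if $C_n|w_n(a_n)|\ge\|w_n\|_E$ for all $n\ge1$, where $w_n(z)=(z-a_0)\cdots(z-a_{n-1})$. Markov constant: $M_n(E)=\sup\|p'\|_E/\|p\|_E$, the supremum over all nonzero complex polynomials $p$ of degree at most $n$. *)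

theory Defs
  imports "HOL-Complex_Analysis.Complex_Analysis" "HOL-Computational_Algebra.Polynomial"
begin

(* On a nonempty compact E and for continuous f the supremum is the maximum of |f|. *)
definition sup_norm :: "complex set \<Rightarrow> (complex \<Rightarrow> complex) \<Rightarrow> real" where
  "sup_norm E f = (SUP z\<in>E. cmod (f z))"

definition poly_hull :: "complex set \<Rightarrow> complex set" where
  "poly_hull E = {z. \<forall>p :: complex poly. cmod (poly p z) \<le> sup_norm E (poly p)}"

(* C^2 functions with u_xx + u_yy = 0: ux, uy are the first and uxx, uxy, uyx, uyy the
   second partial derivatives of u, with z = x + i y. *)
definition harmonic_on :: "(complex \<Rightarrow> real) \<Rightarrow> complex set \<Rightarrow> bool" where
  "harmonic_on u S \<longleftrightarrow> open S \<and>
     (\<exists>ux uy uxx uxy uyx uyy :: complex \<Rightarrow> real.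
        (\<forall>z\<in>S.
           (u has_derivative (\<lambda>h. ux z * Re h + uy z * Im h)) (at z) \<and>
           (ux has_derivative (\<lambda>h. uxx z * Re h + uxy z * Im h)) (at z) \<and>
           (uy has_derivative (\<lambda>h. uyx z * Re h + uyy z * Im h)) (at z) \<and>
           uxx z + uyy z = 0) \<and>
        continuous_on S uxx \<and> continuous_on S uxy \<and>
        continuous_on S uyx \<and> continuous_on S uyy)"

(* Values of g outside the complement of the hull are irrelevant. *)
definition is_green_function :: "complex set \<Rightarrow> (complex \<Rightarrow> real) \<Rightarrow> bool" where
  "is_green_function E g \<longleftrightarrow>
     harmonic_on g (- poly_hull E) \<and>
     (\<forall>z\<in>- poly_hull E. g z > 0) \<and>
     (\<forall>\<zeta>\<in>frontier (- poly_hull E). (g \<longlongrightarrow> 0) (at \<zeta> within - poly_hull E)) \<and>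
     (\<exists>c :: real. ((\<lambda>z. g z - ln (cmod z)) \<longlongrightarrow> c) at_infinity)"

definition regular_set :: "complex set \<Rightarrow> bool" where
  "regular_set E \<longleftrightarrow> (\<exists>g. is_green_function E g)"

definition node_poly :: "(nat \<Rightarrow> complex) \<Rightarrow> nat \<Rightarrow> complex \<Rightarrow> complex" where
  "node_poly a n z = (\<Prod>j<n. z - a j)"

(* Only the values C n with n >= 1 matter. *)
definition pseudo_leja :: "complex set \<Rightarrow> (nat \<Rightarrow> real) \<Rightarrow> (nat \<Rightarrow> complex) \<Rightarrow> bool" where
  "pseudo_leja E C a \<longleftrightarrow>
     (\<lambda>n. root n (C n)) \<longlonglongrightarrow> 1 \<and>
     (\<forall>n. a n \<in> E) \<and>
     (\<forall>n\<ge>1. C n * cmod (node_poly a n (a n)) \<ge> sup_norm E (node_poly a n))"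

(* Used for infinite compact E (such as regular compact sets): then the denominators are
   positive and the quotients are bounded above for each n, so the real supremum is genuine. *)
definition markov_const :: "complex set \<Rightarrow> nat \<Rightarrow> real" where
  "markov_const E n =
     (SUP p\<in>{p :: complex poly. p \<noteq> 0 \<and> degree p \<le> n}.
        sup_norm E (poly (pderiv p)) / sup_norm E (poly p))"

(* Meaningful for n >= 1 only. *)
definition min_gap :: "(nat \<Rightarrow> complex) \<Rightarrow> nat \<Rightarrow> real" where
  "min_gap a n = Min ((\<lambda>j. cmod (a n - a j)) ` {..<n})"

end

theory Submission
  imports Defs
begin

text \<open>
  Two estimates carry the proof.

  The first is a Taylor argument. Let \<open>w\<close> be the node polynomial with zeros \<open>a\<^sub>0, \<dots>, a\<^sub>n\<^sub>-\<^sub>1\<close> and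
  \<open>M\<close> the \<open>n\<close>-th Markov constant. Iterating Markov's inequality bounds the \<open>k\<close>-th derivative of
  \<open>w\<close> on \<open>E\<close> by \<open>M\<^sup>k \<parallel>w\<parallel>\<close>, so expanding \<open>w\<close> at its zero \<open>a\<^sub>j\<close> gives
  \<open>\<bar>w a\<^sub>n\<bar> \<le> \<parallel>w\<parallel> (exp (M \<bar>a\<^sub>n - a\<^sub>j\<bar>) - 1)\<close>. The left side is at least \<open>\<parallel>w\<parallel> / C\<^sub>n\<close> by the
  pseudo Leja property; dividing by \<open>\<parallel>w\<parallel>\<close> and taking logarithms gives the lower bound for the gap
  (\<open>poly_increment_le\<close>, \<open>node_distance_lower_bound\<close>). Comparing the two sides of the pseudo
  Leja condition shows \<open>C\<^sub>n \<ge> 1\<close>, whence \<open>ln (1 + 1 / C\<^sub>n) \<ge> 1 / (2 C\<^sub>n)\<close>.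

  The second is that the Markov constants of a regular set grow subexponentially. The Green function
  \<open>g\<close> enters through the Bernstein--Walsh inequality \<open>\<bar>p z\<bar> \<le> \<parallel>p\<parallel> exp (k g z)\<close> for
  \<open>k > degree p\<close>, a consequence of the maximum principle (\<open>bernstein_walsh_inequality\<close>). As \<open>g\<close>
  tends to zero at the hull, which is compact, it is below a given \<open>\<epsilon>\<close> within some distance
  \<open>\<delta>\<close> of the hull; Cauchy's inequality then bounds the \<open>n\<close>-th Markov constant by
  \<open>exp ((n + 1) \<epsilon>) / \<delta>\<close> (\<open>subexponential_markov\<close>). The same inequality shows that
  nonzero polynomials have positive norm on \<open>E\<close>, so that all quotients above make sense.

  The \<open>n\<close>-th roots of the gaps are therefore squeezed between those of
  \<open>\<delta> / (2 C\<^sub>n exp ((n + 1) \<epsilon>))\<close>, which tend to \<open>exp (- \<epsilon>)\<close>, and those of a bound for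
  the diameter of \<open>E\<close>, which tend to \<open>1\<close>.
\<close>

section \<open>The Laplacian along the coordinate axes\<close>

text \<open>The maximum principle below only uses that a function with positive Laplacian has no local
  maximum. For that it suffices to look at the two restrictions \<open>t \<mapsto> u (z + t)\<close> and
  \<open>t \<mapsto> u (z + \<i> t)\<close> and their second derivatives at \<open>0\<close>: mixed partial derivatives, and hence
  harmonic conjugates, never appear.\<close>

definition has_second_deriv :: "(real \<Rightarrow> real) \<Rightarrow> real \<Rightarrow> bool" where
  "has_second_deriv f A \<longleftrightarrow>
     (\<exists>d. (\<forall>\<^sub>F t in nhds 0. (f has_real_derivative d t) (at t)) \<and>
          (d has_real_derivative A) (at 0))"

text \<open>The factor \<open>1\<close> is written out so that both directions are instances of
  \<open>z + c * of_real t\<close>.\<close>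

definition has_laplacian :: "(complex \<Rightarrow> real) \<Rightarrow> complex \<Rightarrow> real \<Rightarrow> bool" where
  "has_laplacian u z L \<longleftrightarrow>
     (\<exists>A B. has_second_deriv (\<lambda>t. u (z + 1 * of_real t)) A \<and>
            has_second_deriv (\<lambda>t. u (z + \<i> * of_real t)) B \<and> L = A + B)"

lemma has_second_derivI:
  assumes "\<forall>\<^sub>F t in nhds 0. (f has_real_derivative d t) (at t)"
    and "(d has_real_derivative A) (at 0)"
  shows "has_second_deriv f A"
  using assms unfolding has_second_deriv_def by blast

lemma has_second_deriv_add:
  assumes "has_second_deriv f A" "has_second_deriv g B"
  shows "has_second_deriv (\<lambda>t. f t + g t) (A + B)"
proof -
  obtain d e where
    d: "\<forall>\<^sub>F t in nhds 0. (f has_real_derivative d t) (at t)" "(d has_real_derivative A) (at 0)" and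
    e: "\<forall>\<^sub>F t in nhds 0. (g has_real_derivative e t) (at t)" "(e has_real_derivative B) (at 0)"
    using assms unfolding has_second_deriv_def by blast
  have "\<forall>\<^sub>F t in nhds 0. ((\<lambda>t. f t + g t) has_real_derivative d t + e t) (at t)"
    using d(1) e(1) by eventually_elim (rule DERIV_add)
  then show ?thesis
    unfolding has_second_deriv_def
    using DERIV_add[OF d(2) e(2)] by (intro exI[of _ "\<lambda>t. d t + e t"]) auto
qed

lemma has_second_deriv_cmult:
  assumes "has_second_deriv f A"
  shows "has_second_deriv (\<lambda>t. c * f t) (c * A)"
proof -
  obtain d where
    d: "\<forall>\<^sub>F t in nhds 0. (f has_real_derivative d t) (at t)" "(d has_real_derivative A) (at 0)"
    using assms unfolding has_second_deriv_def by blast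
  have "\<forall>\<^sub>F t in nhds 0. ((\<lambda>t. c * f t) has_real_derivative c * d t) (at t)"
    using d(1) by eventually_elim (rule DERIV_cmult)
  then show ?thesis
    unfolding has_second_deriv_def
    using DERIV_cmult[OF d(2)] by (intro exI[of _ "\<lambda>t. c * d t"]) auto
qed

lemma has_laplacian_add:
  assumes "has_laplacian u z K" "has_laplacian v z L"
  shows "has_laplacian (\<lambda>w. u w + v w) z (K + L)"
proof -
  obtain A B where AB: "has_second_deriv (\<lambda>t. u (z + 1 * of_real t)) A"
    "has_second_deriv (\<lambda>t. u (z + \<i> * of_real t)) B" "K = A + B"
    using assms(1) unfolding has_laplacian_def by blast
  obtain A' B' where AB': "has_second_deriv (\<lambda>t. v (z + 1 * of_real t)) A'"
    "has_second_deriv (\<lambda>t. v (z + \<i> * of_real t)) B'" "L = A' + B'"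
    using assms(2) unfolding has_laplacian_def by blast
  show ?thesis
    unfolding has_laplacian_def
    using has_second_deriv_add[OF AB(1) AB'(1)] has_second_deriv_add[OF AB(2) AB'(2)] AB(3) AB'(3)
    by (intro exI[of _ "A + A'"] exI[of _ "B + B'"]) auto
qed

lemma has_laplacian_cmult:
  assumes "has_laplacian u z L"
  shows "has_laplacian (\<lambda>w. c * u w) z (c * L)"
proof -
  obtain A B where AB: "has_second_deriv (\<lambda>t. u (z + 1 * of_real t)) A"
    "has_second_deriv (\<lambda>t. u (z + \<i> * of_real t)) B" "L = A + B"
    using assms(1) unfolding has_laplacian_def by blast
  show ?thesis
    unfolding has_laplacian_def
    using has_second_deriv_cmult[OF AB(1), of c] has_second_deriv_cmult[OF AB(2), of c] AB(3)
    by (intro exI[of _ "c * A"] exI[of _ "c * B"]) (auto simp: algebra_simps)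
qed

lemma eventually_line_mem:
  assumes "open S" "z \<in> S"
  shows "\<forall>\<^sub>F t in nhds 0. z + c * of_real t \<in> (S :: complex set)"
proof -
  have "isCont (\<lambda>t::real. z + c * of_real t) 0"
    by (intro continuous_intros)
  then have "((\<lambda>t::real. z + c * of_real t) \<longlongrightarrow> z) (nhds 0)"
    using tendsto_at_iff_tendsto_nhds[of "\<lambda>t::real. z + c * of_real t" 0] by (simp add: isCont_def)
  then show ?thesis
    using assms topological_tendstoD by blast
qed

lemma line_has_derivative:
  "((\<lambda>t::real. z + c * complex_of_real t) has_derivative (\<lambda>t. c * of_real t)) (at t)"
  by (auto intro!: derivative_eq_intros)

lemma has_real_derivative_along_line:
  fixes u :: "complex \<Rightarrow> real"
  assumes "(u has_derivative (\<lambda>h. p * Re h + q * Im h)) (at (z + c * of_real t))"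
  shows "((\<lambda>t. u (z + c * of_real t)) has_real_derivative p * Re c + q * Im c) (at t)"
proof -
  have "((\<lambda>t. u (z + c * of_real t)) has_derivative
        (\<lambda>s. p * Re (c * of_real s) + q * Im (c * of_real s))) (at t)"
    by (rule has_derivative_compose[OF line_has_derivative assms])
  moreover have "(\<lambda>s. p * Re (c * of_real s) + q * Im (c * of_real s)) = (*) (p * Re c + q * Im c)"
    by (auto simp: fun_eq_iff algebra_simps)
  ultimately show ?thesis
    unfolding has_field_derivative_def by simp
qed

lemma harmonic_on_imp_has_laplacian:
  assumes "harmonic_on u S" "z \<in> S"
  shows "has_laplacian u z 0"
proof -
  obtain ux uy uxx uxy uyx uyy :: "complex \<Rightarrow> real" where S: "open S" and
    d: "\<And>z. z \<in> S \<Longrightarrow> (u has_derivative (\<lambda>h. ux z * Re h + uy z * Im h)) (at z)"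
       "\<And>z. z \<in> S \<Longrightarrow> (ux has_derivative (\<lambda>h. uxx z * Re h + uxy z * Im h)) (at z)"
       "\<And>z. z \<in> S \<Longrightarrow> (uy has_derivative (\<lambda>h. uyx z * Re h + uyy z * Im h)) (at z)"
       "\<And>z. z \<in> S \<Longrightarrow> uxx z + uyy z = 0"
    using assms(1) unfolding harmonic_on_def by blast
  have "\<forall>\<^sub>F t in nhds 0. ((\<lambda>t. u (z + 1 * of_real t)) has_real_derivative ux (z + 1 * of_real t)) (at t)"
    using eventually_line_mem[OF S assms(2), of 1]
    by eventually_elim (use has_real_derivative_along_line[OF d(1), of z 1] in simp)
  moreover have "((\<lambda>t. ux (z + 1 * of_real t)) has_real_derivative uxx z) (at 0)"
    using has_real_derivative_along_line[of ux "uxx z" "uxy z" z 1 0] d(2)[OF assms(2)] by simp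
  ultimately have 1: "has_second_deriv (\<lambda>t. u (z + 1 * of_real t)) (uxx z)"
    by (rule has_second_derivI)
  have "\<forall>\<^sub>F t in nhds 0. ((\<lambda>t. u (z + \<i> * of_real t)) has_real_derivative uy (z + \<i> * of_real t)) (at t)"
    using eventually_line_mem[OF S assms(2), of \<i>]
    by eventually_elim (use has_real_derivative_along_line[OF d(1), of z \<i>] in simp)
  moreover have "((\<lambda>t. uy (z + \<i> * of_real t)) has_real_derivative uyy z) (at 0)"
    using has_real_derivative_along_line[of uy "uyx z" "uyy z" z \<i> 0] d(3)[OF assms(2)] by simp
  ultimately have 2: "has_second_deriv (\<lambda>t. u (z + \<i> * of_real t)) (uyy z)"
    by (rule has_second_derivI)
  show ?thesis
    unfolding has_laplacian_def using 1 2 d(4)[OF assms(2)]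
    by (intro exI[of _ "uxx z"] exI[of _ "uyy z"]) simp
qed

lemma has_real_derivative_Re_along_line:
  assumes "(F has_field_derivative D) (at (z + c * of_real t))"
  shows "((\<lambda>t. Re (F (z + c * of_real t))) has_real_derivative Re (c * D)) (at t)"
proof -
  have "((\<lambda>t. F (z + c * of_real t)) has_derivative (\<lambda>s. D * (c * of_real s))) (at t)"
    using has_derivative_compose[OF line_has_derivative assms[unfolded has_field_derivative_def]] .
  then have "((\<lambda>t. Re (F (z + c * of_real t))) has_derivative (\<lambda>s. Re (D * (c * of_real s)))) (at t)"
    by (rule has_derivative_Re)
  moreover have "(\<lambda>s. Re (D * (c * of_real s))) = (*) (Re (c * D))"
    by (auto simp: fun_eq_iff algebra_simps)
  ultimately show ?thesis
    unfolding has_field_derivative_def by simp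
qed

text \<open>Along the direction \<open>c\<close> the second derivative of \<open>Re F\<close> is \<open>Re (c\<^sup>2 F'')\<close>, and
  the squares of \<open>1\<close> and \<open>\<i>\<close> cancel.\<close>

lemma has_laplacian_Re_holomorphic:
  assumes "F holomorphic_on S" "open S" "z \<in> S"
  shows "has_laplacian (\<lambda>w. Re (F w)) z 0"
proof -
  have sd: "has_second_deriv (\<lambda>t. Re (F (z + c * of_real t))) (Re (c * (c * deriv (deriv F) z)))" for c
  proof -
    have "\<forall>\<^sub>F t in nhds 0. ((\<lambda>t. Re (F (z + c * of_real t))) has_real_derivative
            Re (c * deriv F (z + c * of_real t))) (at t)"
      using eventually_line_mem[OF assms(2,3), of c]
      by eventually_elim
        (intro has_real_derivative_Re_along_line holomorphic_derivI[OF assms(1,2)])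
    moreover have "((\<lambda>w. c * deriv F w) has_field_derivative c * deriv (deriv F) z)
        (at (z + c * of_real 0))"
      using DERIV_cmult[OF holomorphic_derivI[OF holomorphic_deriv[OF assms(1,2)] assms(2,3)]] by simp
    then have "((\<lambda>t. Re (c * deriv F (z + c * of_real t))) has_real_derivative
            Re (c * (c * deriv (deriv F) z))) (at 0)"
      by (rule has_real_derivative_Re_along_line)
    ultimately show ?thesis
      by (rule has_second_derivI)
  qed
  show ?thesis
    unfolding has_laplacian_def using sd[of 1] sd[of \<i>]
    by (intro exI[of _ "Re (1 * (1 * deriv (deriv F) z))"] exI[of _ "Re (\<i> * (\<i> * deriv (deriv F) z))"])
       simp
qed

lemma has_laplacian_cong:
  assumes "has_laplacian u z L" "open S" "z \<in> S" "\<And>w. w \<in> S \<Longrightarrow> u w = v w"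
  shows "has_laplacian v z L"
proof -
  have *: "has_second_deriv (\<lambda>t. v (z + c * of_real t)) A"
    if A: "has_second_deriv (\<lambda>t. u (z + c * of_real t)) A" for c A
  proof -
    obtain d where
      d: "\<forall>\<^sub>F t in nhds 0. ((\<lambda>t. u (z + c * of_real t)) has_real_derivative d t) (at t)"
         "(d has_real_derivative A) (at 0)"
      using A unfolding has_second_deriv_def by blast
    have "\<forall>\<^sub>F t in nhds 0. u (z + c * of_real t) = v (z + c * of_real t)"
      using eventually_line_mem[OF assms(2,3), of c] by eventually_elim (rule assms(4))
    then have "\<forall>\<^sub>F t in nhds 0. \<forall>\<^sub>F s in nhds t. u (z + c * of_real s) = v (z + c * of_real s)"
      by (simp add: eventually_eventually)
    with d(1) have "\<forall>\<^sub>F t in nhds 0. ((\<lambda>t. v (z + c * of_real t)) has_real_derivative d t) (at t)"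
    proof eventually_elim
      case (elim t)
      then show ?case
        using DERIV_cong_ev[OF refl elim(2) refl] by blast
    qed
    with d(2) show ?thesis
      unfolding has_second_deriv_def by blast
  qed
  show ?thesis
    using assms(1) * unfolding has_laplacian_def by blast
qed

text \<open>Near a point where \<open>p\<close> does not vanish, \<open>p = exp F\<close> with \<open>F\<close> holomorphic, so
  \<open>ln \<bar>p\<bar> = Re F\<close>.\<close>

lemma has_laplacian_ln_cmod_poly:
  assumes "poly p z \<noteq> 0"
  shows "has_laplacian (\<lambda>w. ln (cmod (poly p w))) z 0"
proof -
  have "open {w. poly p w \<noteq> 0}"
    by (intro open_Collect_neq continuous_intros)
  then obtain r where r: "r > 0" "ball z r \<subseteq> {w. poly p w \<noteq> 0}"
    using assms by (elim openE[of _ z]) auto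
  have hol: "poly p holomorphic_on ball z r"
    by (intro holomorphic_intros)
  obtain F where F: "F holomorphic_on ball z r" "\<And>w. w \<in> ball z r \<Longrightarrow> poly p w = exp (F w)"
    using contractible_imp_holomorphic_log[OF hol convex_imp_contractible[OF convex_ball]] r(2) by blast
  have "has_laplacian (\<lambda>w. Re (F w)) z 0"
    using has_laplacian_Re_holomorphic[OF F(1)] r(1) by simp
  then show ?thesis
    by (rule has_laplacian_cong[of _ _ _ "ball z r"]) (use F(2) r(1) in auto)
qed

lemma has_laplacian_norm_square: "has_laplacian (\<lambda>w. (cmod w)\<^sup>2) z 4"
proof -
  have 1: "has_second_deriv (\<lambda>t. (cmod (z + 1 * of_real t))\<^sup>2) 2"
    unfolding has_second_deriv_def cmod_power2
    by (intro exI[of _ "\<lambda>t. 2 * (Re z + t)"]) (auto intro!: derivative_eq_intros always_eventually)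
  have 2: "has_second_deriv (\<lambda>t. (cmod (z + \<i> * of_real t))\<^sup>2) 2"
    unfolding has_second_deriv_def cmod_power2
    by (intro exI[of _ "\<lambda>t. 2 * (Im z + t)"]) (auto intro!: derivative_eq_intros always_eventually)
  show ?thesis
    unfolding has_laplacian_def using 1 2 by (intro exI[of _ 2]) simp
qed

text \<open>At a local maximum the first derivative \<open>d\<close> vanishes; if its own derivative were positive,
  \<open>d\<close> would be positive just to the right, and the mean value theorem would make \<open>f\<close> exceed its
  maximum.\<close>

lemma second_deriv_nonpos_at_local_max:
  assumes "has_second_deriv f A" "\<forall>\<^sub>F t in nhds 0. f t \<le> f 0"
  shows "A \<le> 0"
proof (rule ccontr)
  assume "\<not> A \<le> 0"
  then have A: "A > 0" by simp
  obtain d where d: "\<forall>\<^sub>F t in nhds 0. (f has_real_derivative d t) (at t)" "(d has_real_derivative A) (at 0)"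
    using assms(1) unfolding has_second_deriv_def by blast
  have "\<forall>\<^sub>F t in nhds 0. (f has_real_derivative d t) (at t) \<and> f t \<le> f 0"
    using d(1) assms(2) by (rule eventually_conj)
  then obtain r where r: "r > 0"
    "\<And>t. \<bar>t\<bar> < r \<Longrightarrow> (f has_real_derivative d t) (at t)"
    "\<And>t. \<bar>t\<bar> < r \<Longrightarrow> f t \<le> f 0"
    unfolding eventually_nhds_metric dist_real_def by auto
  have d0: "d 0 = 0"
    by (rule DERIV_local_max[OF r(2)[of 0] r(1)]) (use r in auto)
  obtain s where s: "s > 0" "\<And>h. 0 < h \<Longrightarrow> h < s \<Longrightarrow> d 0 < d (0 + h)"
    using DERIV_pos_inc_right[OF d(2) A] by blast
  define h where "h = min r s / 2"
  have h: "0 < h" "h < r" "h < s"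
    using r(1) s(1) by (auto simp: h_def min_def)
  obtain x where x: "0 < x" "x < h" "f h - f 0 = (h - 0) * d x"
    using MVT2[OF h(1), of f d] r(2) h by auto
  have "d x > 0"
    using s(2)[of x] x h d0 by simp
  then have "f h > f 0"
    using x h by (smt (verit) mult_pos_pos)
  then show False
    using r(3)[of h] h by simp
qed

lemma laplacian_nonpos_at_local_max:
  assumes "has_laplacian u z L" "\<forall>\<^sub>F w in nhds z. u w \<le> u z"
  shows "L \<le> 0"
proof -
  have max: "\<forall>\<^sub>F t in nhds 0. u (z + c * of_real t) \<le> u (z + c * of_real 0)" for c
  proof -
    obtain S where S: "open S" "z \<in> S" "\<And>w. w \<in> S \<Longrightarrow> u w \<le> u z"
      using assms(2) unfolding eventually_nhds by blast
    show ?thesis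
      using eventually_line_mem[OF S(1,2), of c] by eventually_elim (use S(3) in simp)
  qed
  obtain A B where AB: "has_second_deriv (\<lambda>t. u (z + 1 * of_real t)) A"
    "has_second_deriv (\<lambda>t. u (z + \<i> * of_real t)) B" "L = A + B"
    using assms(1) unfolding has_laplacian_def by blast
  show ?thesis
    using second_deriv_nonpos_at_local_max[OF AB(1) max[of 1]]
      second_deriv_nonpos_at_local_max[OF AB(2) max[of \<i>]] AB(3) by simp
qed

section \<open>The polynomial hull and its complement\<close>

lemma cmod_le_sup_norm:
  assumes "compact E" "continuous_on E f" "z \<in> E"
  shows "cmod (f z) \<le> sup_norm E f"
proof -
  have "bounded ((\<lambda>z. cmod (f z)) ` E)"
    using assms by (intro compact_imp_bounded compact_continuous_image continuous_intros)
  then show ?thesis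
    unfolding sup_norm_def using assms(3) bounded_imp_bdd_above by (intro cSUP_upper)
qed

lemma cmod_poly_le_sup_norm:
  assumes "compact E" "z \<in> E"
  shows "cmod (poly p z) \<le> sup_norm E (poly p)"
  using assms by (intro cmod_le_sup_norm continuous_intros)

lemma sup_norm_le:
  assumes "E \<noteq> {}" "\<And>z. z \<in> E \<Longrightarrow> cmod (f z) \<le> B"
  shows "sup_norm E f \<le> B"
  unfolding sup_norm_def using assms by (intro cSUP_least)

lemma sup_norm_poly_nonneg:
  assumes "compact E" "E \<noteq> {}"
  shows "0 \<le> sup_norm E (poly p)"
  using assms cmod_poly_le_sup_norm[OF assms(1), of _ p] norm_ge_zero order_trans by blast

lemma cmod_poly_le_on_hull: "z \<in> poly_hull E \<Longrightarrow> cmod (poly p z) \<le> sup_norm E (poly p)"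
  unfolding poly_hull_def by blast

lemma subset_poly_hull: "compact E \<Longrightarrow> E \<subseteq> poly_hull E"
  unfolding poly_hull_def using cmod_poly_le_sup_norm by blast

lemma compact_poly_hull: "compact (poly_hull E)"
proof -
  have "poly_hull E = (\<Inter>p. {z. cmod (poly p z) \<le> sup_norm E (poly p)})"
    unfolding poly_hull_def by blast
  moreover have "closed (\<Inter>p. {z. cmod (poly p z) \<le> sup_norm E (poly p)})"
    by (intro closed_INT ballI closed_Collect_le continuous_intros)
  ultimately have "closed (poly_hull E)"
    by simp
  moreover have "cmod z \<le> sup_norm E (poly [:0, 1:])" if "z \<in> poly_hull E" for z
    using cmod_poly_le_on_hull[OF that, of "[:0, 1:]"] by simp
  then have "bounded (poly_hull E)"
    unfolding bounded_iff by blast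
  ultimately show ?thesis
    by (simp add: compact_eq_bounded_closed)
qed

section \<open>The Bernstein--Walsh inequality\<close>

lemma poly_over_power_tendsto_0:
  fixes p :: "complex poly"
  assumes "degree p < k"
  shows "((\<lambda>z. poly p z / z ^ k) \<longlongrightarrow> 0) at_infinity"
proof -
  have monomial: "((\<lambda>z::complex. coeff p i * z ^ i / z ^ k) \<longlongrightarrow> 0) at_infinity" if i: "i \<le> degree p" for i
  proof -
    have ki: "k = i + (k - i)" "k - i > 0"
      using assms i by auto
    have "((\<lambda>z::complex. coeff p i * inverse z ^ (k - i)) \<longlongrightarrow> coeff p i * 0 ^ (k - i)) at_infinity"
      by (intro tendsto_intros tendsto_inverse_0)
    then have lim: "((\<lambda>z::complex. coeff p i * inverse z ^ (k - i)) \<longlongrightarrow> 0) at_infinity"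
      using ki by (simp add: zero_power)
    have "\<forall>\<^sub>F z::complex in at_infinity. z \<noteq> 0"
      unfolding eventually_at_infinity by (intro exI[of _ 1]) auto
    then have "\<forall>\<^sub>F z in at_infinity. coeff p i * inverse z ^ (k - i) = coeff p i * z ^ i / z ^ k"
    proof eventually_elim
      case (elim z)
      have "z ^ k = z ^ i * z ^ (k - i)"
        using ki(1) by (metis power_add)
      then show ?case
        using elim by (simp add: field_simps)
    qed
    then show ?thesis
      using lim tendsto_cong by force
  qed
  have "((\<lambda>z. \<Sum>i\<le>degree p. coeff p i * z ^ i / z ^ k) \<longlongrightarrow> (\<Sum>i\<le>degree p. 0)) at_infinity"
    by (intro tendsto_sum monomial) auto
  then show ?thesis
    by (simp add: poly_altdef sum_divide_distrib)
qed

locale green_function =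
  fixes E :: "complex set" and g :: "complex \<Rightarrow> real"
  assumes compact: "compact E" and nonempty: "E \<noteq> {}" and green: "is_green_function E g"
begin

lemma open_compl_hull: "open (- poly_hull E)"
  using compact_poly_hull compact_imp_closed by blast

lemma g_laplacian: "z \<notin> poly_hull E \<Longrightarrow> has_laplacian g z 0"
  using green harmonic_on_imp_has_laplacian unfolding is_green_function_def by fastforce

lemma g_continuous:
  assumes "z \<notin> poly_hull E"
  shows "isCont g z"
proof -
  have "harmonic_on g (- poly_hull E)"
    using green unfolding is_green_function_def by blast
  then obtain ux uy :: "complex \<Rightarrow> real" where
    "\<forall>z\<in>- poly_hull E. (g has_derivative (\<lambda>h. ux z * Re h + uy z * Im h)) (at z)"
    unfolding harmonic_on_def by blast
  then have "(g has_derivative (\<lambda>h. ux z * Re h + uy z * Im h)) (at z)"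
    using assms by blast
  then show ?thesis
    by (rule has_derivative_continuous)
qed

lemma g_tendsto_0:
  assumes "z \<in> poly_hull E" "z islimpt - poly_hull E"
  shows "(g \<longlongrightarrow> 0) (at z within - poly_hull E)"
proof -
  have "z \<in> frontier (- poly_hull E)"
    using assms open_compl_hull by (simp add: frontier_def closure_def interior_open)
  then show ?thesis
    using green unfolding is_green_function_def by blast
qed

text \<open>A superlevel set in the complement of the hull cannot accumulate at the hull if the boundary
  values of \<open>f\<close> stay below the level. This serves twice: for the set on which the Bernstein--Walsh
  inequality might fail, and for the set on which the Green function is not small.\<close>

lemma closed_superlevel:
  fixes f :: "complex \<Rightarrow> real"
  assumes cont: "\<And>z. z \<notin> poly_hull E \<Longrightarrow> isCont f z"
    and bdry: "\<And>z. z \<in> poly_hull E \<Longrightarrow> z islimpt - poly_hull E \<Longrightarrow>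
                 \<exists>l<c. (f \<longlongrightarrow> l) (at z within - poly_hull E)"
  shows "closed {z. z \<notin> poly_hull E \<and> c \<le> f z}" (is "closed ?K")
  unfolding closed_limpt
proof (intro allI impI)
  fix z assume z: "z islimpt ?K"
  have lim': "z islimpt - poly_hull E"
    by (rule islimpt_subset[OF z]) auto
  have nontriv: "at z within ?K \<noteq> bot"
    using z trivial_limit_within by blast
  have ev: "\<forall>\<^sub>F w in at z within ?K. c \<le> f w"
    unfolding eventually_at_filter by (intro always_eventually) auto
  show "z \<in> ?K"
  proof (cases "z \<in> poly_hull E")
    case True
    then obtain l where l: "l < c" "(f \<longlongrightarrow> l) (at z within - poly_hull E)"
      using bdry lim' by blast
    have "(f \<longlongrightarrow> l) (at z within ?K)"
      by (rule tendsto_within_subset[OF l(2)]) auto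
    then have "c \<le> l"
      using tendsto_lowerbound ev nontriv by blast
    with l(1) show ?thesis by simp
  next
    case False
    have "(f \<longlongrightarrow> f z) (at z within ?K)"
      using cont[OF False] unfolding isCont_def by (rule tendsto_within_subset) auto
    then have "c \<le> f z"
      using tendsto_lowerbound ev nontriv by blast
    then show ?thesis
      using False by simp
  qed
qed

text \<open>Since \<open>g\<close> behaves like \<open>ln \<bar>z\<bar>\<close> at infinity, the weight \<open>exp (- k g)\<close> decays like
  \<open>\<bar>z\<bar>\<close> to the power \<open>- k\<close>.\<close>

lemma weighted_poly_tendsto_0:
  assumes "degree p < k"
  shows "((\<lambda>z. cmod (poly p z) * exp (- real k * g z)) \<longlongrightarrow> 0) at_infinity"
proof -
  obtain c where c: "((\<lambda>z. g z - ln (cmod z)) \<longlongrightarrow> c) at_infinity"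
    using green unfolding is_green_function_def by blast
  have "((\<lambda>z. cmod (poly p z / z ^ k) * exp (- real k * (g z - ln (cmod z)))) \<longlongrightarrow>
          cmod 0 * exp (- real k * c)) at_infinity"
    by (intro tendsto_intros c poly_over_power_tendsto_0 assms)
  moreover have "\<forall>\<^sub>F z::complex in at_infinity. z \<noteq> 0"
    unfolding eventually_at_infinity by (intro exI[of _ 1]) auto
  then have "\<forall>\<^sub>F z in at_infinity. cmod (poly p z / z ^ k) * exp (- real k * (g z - ln (cmod z)))
      = cmod (poly p z) * exp (- real k * g z)"
  proof eventually_elim
    case (elim z)
    have "exp (- real k * (g z - ln (cmod z))) = exp (- real k * g z) * exp (real k * ln (cmod z))"
      by (simp add: algebra_simps flip: exp_add)
    also have "exp (real k * ln (cmod z)) = cmod z ^ k"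
      using elim by (simp add: exp_of_nat_mult)
    finally show ?case
      using elim by (simp add: norm_divide norm_power)
  qed
  ultimately show ?thesis
    using tendsto_cong by force
qed

text \<open>The maximum principle for \<open>ln \<bar>p\<bar> - k g\<close>, which is harmonic off the zeros of \<open>p\<close> and has
  boundary values at most \<open>ln \<parallel>p\<parallel>\<close>. The classical inequality has \<open>k = degree p\<close>; taking \<open>k\<close> strictly
  larger makes the function tend to \<open>- \<infinity>\<close> at infinity, so that infinity needs no separate treatment,
  and one extra factor \<open>exp g\<close> is harmless after extraction of \<open>n\<close>-th roots.

  If the inequality failed, then on a compact superlevel set \<open>K\<close> of \<open>f = \<bar>p\<bar> exp (- k g)\<close> the
  function \<open>\<phi> = ln f + e \<bar>z\<bar>\<^sup>2\<close> would attain its maximum, for small \<open>e\<close> at an interior point. But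
  its Laplacian there is \<open>4 e > 0\<close>.

  The norm of \<open>p\<close> may be zero here; this case shows below that a nonzero polynomial cannot vanish
  on \<open>E\<close>.\<close>

lemma bernstein_walsh_inequality:
  assumes "degree p < k" "z0 \<notin> poly_hull E"
  shows "cmod (poly p z0) \<le> sup_norm E (poly p) * exp (real k * g z0)"
proof (rule ccontr)
  define m where "m = sup_norm E (poly p)"
  define f where "f z = cmod (poly p z) * exp (- real k * g z)" for z
  assume "\<not> ?thesis"
  then have "f z0 > m"
    by (simp add: f_def m_def exp_minus field_simps)
  then obtain M where M: "m < M" "M < f z0"
    using dense by blast
  have "m \<ge> 0"
    unfolding m_def using sup_norm_poly_nonneg[OF compact nonempty] .
  with M have "M > 0" by simp
  define K where "K = {z. z \<notin> poly_hull E \<and> M \<le> f z}"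
  have fcont: "isCont f z" if "z \<notin> poly_hull E" for z
    unfolding f_def by (intro continuous_intros g_continuous that)
  have "closed K"
    unfolding K_def
  proof (rule closed_superlevel[OF fcont])
    fix z assume z: "z \<in> poly_hull E" "z islimpt - poly_hull E"
    have "(f \<longlongrightarrow> cmod (poly p z) * exp (- real k * 0)) (at z within - poly_hull E)"
      unfolding f_def by (intro tendsto_intros g_tendsto_0 z)
    moreover have "cmod (poly p z) \<le> m"
      unfolding m_def by (rule cmod_poly_le_on_hull[OF z(1)])
    ultimately show "\<exists>l<M. (f \<longlongrightarrow> l) (at z within - poly_hull E)"
      using M(1) by (intro exI[of _ "cmod (poly p z)"]) auto
  qed
  moreover have "\<forall>\<^sub>F z in at_infinity. f z < M"
    using weighted_poly_tendsto_0[OF assms(1)] \<open>M > 0\<close> unfolding f_def by (rule order_tendstoD)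
  then obtain R where R: "\<And>z. R \<le> cmod z \<Longrightarrow> f z < M"
    unfolding eventually_at_infinity by blast
  have KR: "cmod z \<le> R" if "z \<in> K" for z
    using R[of z] that unfolding K_def by fastforce
  then have "bounded K"
    unfolding bounded_iff by blast
  ultimately have "compact K"
    by (simp add: compact_eq_bounded_closed)
  have z0: "z0 \<in> K"
    using assms(2) M(2) by (simp add: K_def)
  have "R \<ge> 0"
    using KR[OF z0] norm_ge_zero order_trans by blast
  \<comment> \<open>With this \<open>e\<close> the perturbation is, on all of \<open>K\<close>, smaller than the gap between the value
    of \<open>ln f\<close> at \<open>z0\<close> and its value \<open>ln M\<close> on the edge of \<open>K\<close>; adding \<open>1\<close> avoids a division
    by zero.\<close>
  define D where "D = R\<^sup>2 + 1"
  define e where "e = (ln (f z0) - ln M) / 2 / D"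
  have gap: "ln (f z0) - ln M > 0"
    using M \<open>M > 0\<close> by simp
  have "D > 0"
    by (simp add: D_def add_nonneg_pos)
  with gap have "e > 0"
    by (simp add: e_def)
  have "e * R\<^sup>2 \<le> e * D"
    using \<open>e > 0\<close> by (simp add: D_def)
  also have "\<dots> = (ln (f z0) - ln M) / 2"
    using \<open>D > 0\<close> by (simp add: e_def)
  finally have eR: "e * R\<^sup>2 < ln (f z0) - ln M"
    using gap by simp
  define \<phi> where "\<phi> z = ln (f z) + e * (cmod z)\<^sup>2" for z
  have fpos: "f z > 0" if "z \<in> K" for z
    using that \<open>M > 0\<close> by (auto simp: K_def)
  have "continuous_on K \<phi>"
    unfolding \<phi>_def
    using fpos fcont by (intro continuous_intros continuous_at_imp_continuous_on) (force simp: K_def)+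
  then obtain z1 where z1: "z1 \<in> K" "\<And>w. w \<in> K \<Longrightarrow> \<phi> w \<le> \<phi> z1"
    using continuous_attains_sup[OF \<open>compact K\<close>] z0 by blast
  have "f z1 > M"
  proof (rule ccontr)
    assume "\<not> f z1 > M"
    then have "f z1 = M"
      using z1(1) by (simp add: K_def)
    moreover have "e * (cmod z1)\<^sup>2 \<le> e * R\<^sup>2"
      using KR[OF z1(1)] \<open>e > 0\<close> by (intro mult_left_mono power_mono) auto
    ultimately have "\<phi> z1 < ln (f z0)"
      using eR by (simp add: \<phi>_def)
    also have "ln (f z0) \<le> \<phi> z0"
      using \<open>e > 0\<close> by (simp add: \<phi>_def)
    finally show False
      using z1(2)[OF z0] by simp
  qed
  have z1D: "z1 \<notin> poly_hull E"
    using z1(1) by (simp add: K_def)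
  have "(f \<longlongrightarrow> f z1) (nhds z1)"
    using fcont[OF z1D] tendsto_at_iff_tendsto_nhds[of f z1] by (simp add: isCont_def)
  then have "\<forall>\<^sub>F w in nhds z1. M < f w"
    using \<open>f z1 > M\<close> by (rule order_tendstoD)
  moreover have "\<forall>\<^sub>F w in nhds z1. w \<notin> poly_hull E"
    using eventually_nhds_in_open[OF open_compl_hull, of z1] z1D by simp
  ultimately have "\<forall>\<^sub>F w in nhds z1. w \<in> K"
    by eventually_elim (simp add: K_def)
  then have locmax: "\<forall>\<^sub>F w in nhds z1. \<phi> w \<le> \<phi> z1"
    by eventually_elim (rule z1(2))
  have "poly p z1 \<noteq> 0"
    using fpos[OF z1(1)] by (auto simp: f_def)
  then have lap: "has_laplacian (\<lambda>w. ln (cmod (poly p w)) + (- real k) * g w + e * (cmod w)\<^sup>2) z1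
      (0 + (- real k) * 0 + e * 4)"
    by (intro has_laplacian_add has_laplacian_cmult has_laplacian_ln_cmod_poly
        has_laplacian_norm_square g_laplacian z1D)
  have "open {w. poly p w \<noteq> 0}"
    by (intro open_Collect_neq continuous_intros)
  then have "has_laplacian \<phi> z1 (0 + (- real k) * 0 + e * 4)"
    by (rule has_laplacian_cong[OF lap]) (use \<open>poly p z1 \<noteq> 0\<close> in \<open>auto simp: \<phi>_def f_def ln_mult\<close>)
  then show False
    using laplacian_nonpos_at_local_max[OF _ locmax] \<open>e > 0\<close> by fastforce
qed

text \<open>In particular \<open>E\<close> is infinite: if \<open>p\<close> vanished on \<open>E\<close>, the Bernstein--Walsh
  inequality would force \<open>p = 0\<close> on the whole plane.\<close>

lemma sup_norm_poly_pos:
  assumes "p \<noteq> 0"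
  shows "0 < sup_norm E (poly p)"
proof (rule ccontr)
  assume "\<not> 0 < sup_norm E (poly p)"
  then have 0: "sup_norm E (poly p) = 0"
    using sup_norm_poly_nonneg[OF compact nonempty, of p] by simp
  have "poly p z = 0" for z
    using cmod_poly_le_on_hull[of z E p] bernstein_walsh_inequality[of p "Suc (degree p)" z] 0
    by (cases "z \<in> poly_hull E") auto
  then show False
    using assms poly_all_0_iff_0 by blast
qed

lemma green_small_near_hull:
  assumes "\<epsilon> > 0"
  shows "\<exists>\<delta>>0. \<forall>w\<in>poly_hull E. \<forall>z\<in>cball w \<delta>. z \<notin> poly_hull E \<longrightarrow> g z < \<epsilon>"
proof -
  define K where "K = {z. z \<notin> poly_hull E \<and> \<epsilon> \<le> g z}"
  have "closed K"
    unfolding K_def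
  proof (rule closed_superlevel)
    show "\<exists>l<\<epsilon>. (g \<longlongrightarrow> l) (at z within - poly_hull E)"
      if "z \<in> poly_hull E" "z islimpt - poly_hull E" for z
      using g_tendsto_0[OF that] assms by blast
  qed (rule g_continuous)
  moreover have "poly_hull E \<inter> K = {}"
    by (auto simp: K_def)
  ultimately obtain d where d: "d > 0" "\<And>w z. w \<in> poly_hull E \<Longrightarrow> z \<in> K \<Longrightarrow> d \<le> dist w z"
    using separate_compact_closed[OF compact_poly_hull, of K E] by auto
  show ?thesis
  proof (intro exI[of _ "d / 2"] conjI ballI impI)
    fix w z assume *: "w \<in> poly_hull E" "z \<in> cball w (d / 2)" "z \<notin> poly_hull E"
    show "g z < \<epsilon>"
    proof (rule ccontr)
      assume "\<not> g z < \<epsilon>"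
      then have "d \<le> dist w z"
        using * d(2) by (simp add: K_def)
      with * d(1) show False
        by simp
    qed
  qed (use d in simp)
qed

text \<open>Close to the hull the Bernstein--Walsh inequality bounds \<open>p\<close> by
  \<open>\<parallel>p\<parallel> exp ((n + 1) \<epsilon>)\<close>, and Cauchy's inequality on circles of radius \<open>\<delta>\<close> turns this into
  a bound for \<open>p'\<close>. The point is that \<open>\<delta>\<close> depends on \<open>\<epsilon>\<close> only, not on the degree.\<close>

lemma subexponential_markov:
  assumes "\<epsilon> > 0"
  shows "\<exists>\<delta>>0. \<forall>n p. degree p \<le> n \<longrightarrow>
    sup_norm E (poly (pderiv p)) \<le> exp (real (Suc n) * \<epsilon>) / \<delta> * sup_norm E (poly p)"
proof -
  obtain \<delta> where \<delta>: "\<delta> > 0" "\<And>w z. w \<in> poly_hull E \<Longrightarrow> z \<in> cball w \<delta> \<Longrightarrow> z \<notin> poly_hull E \<Longrightarrow> g z < \<epsilon>"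
    using green_small_near_hull[OF assms] by blast
  have "sup_norm E (poly (pderiv p)) \<le> exp (real (Suc n) * \<epsilon>) / \<delta> * sup_norm E (poly p)"
    if deg: "degree p \<le> n" for n and p
  proof (rule sup_norm_le[OF nonempty])
    define m where "m = sup_norm E (poly p)"
    have m: "m \<ge> 0"
      unfolding m_def by (rule sup_norm_poly_nonneg[OF compact nonempty])
    fix w assume "w \<in> E"
    then have w: "w \<in> poly_hull E"
      using subset_poly_hull[OF compact] by blast
    have bound: "cmod (poly p z) \<le> m * exp (real (Suc n) * \<epsilon>)" if z: "z \<in> cball w \<delta>" for z
    proof (cases "z \<in> poly_hull E")
      case True
      have "m * 1 \<le> m * exp (real (Suc n) * \<epsilon>)"
        using assms m by (intro mult_left_mono) auto
      then show ?thesis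
        using cmod_poly_le_on_hull[OF True, of p] by (simp add: m_def)
    next
      case False
      have "cmod (poly p z) \<le> m * exp (real (Suc n) * g z)"
        unfolding m_def using deg False by (intro bernstein_walsh_inequality) auto
      also have "\<dots> \<le> m * exp (real (Suc n) * \<epsilon>)"
        using \<delta>(2)[OF w z False] m by (intro mult_left_mono) auto
      finally show ?thesis .
    qed
    have "cmod ((deriv ^^ 1) (poly p) w) \<le> fact 1 * (m * exp (real (Suc n) * \<epsilon>)) / \<delta> ^ 1"
      by (rule Cauchy_inequality)
        (use \<delta>(1) bound in \<open>auto intro!: holomorphic_intros continuous_intros simp: dist_norm\<close>)
    moreover have "deriv (poly p) w = poly (pderiv p) w"
      by (intro DERIV_imp_deriv poly_DERIV)
    ultimately show "cmod (poly (pderiv p) w) \<le> exp (real (Suc n) * \<epsilon>) / \<delta> * sup_norm E (poly p)"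
      by (simp add: m_def mult.commute)
  qed
  then show ?thesis
    using \<delta>(1) by blast
qed

end

section \<open>Markov constants\<close>

lemma higher_deriv_poly: "(deriv ^^ k) (poly (p :: complex poly)) = poly ((pderiv ^^ k) p)"
proof (induction k)
  case (Suc k)
  have "deriv (poly q) = poly (pderiv q)" for q :: "complex poly"
    by (intro ext DERIV_imp_deriv poly_DERIV)
  with Suc show ?case
    by simp
qed simp

context green_function
begin

lemma bdd_above_markov_quotients:
  "bdd_above ((\<lambda>p. sup_norm E (poly (pderiv p)) / sup_norm E (poly p)) ` {p. p \<noteq> 0 \<and> degree p \<le> n})"
proof -
  obtain \<delta> where \<delta>: "\<delta> > 0" "\<And>n p. degree p \<le> n \<Longrightarrow>
      sup_norm E (poly (pderiv p)) \<le> exp (real (Suc n) * 1) / \<delta> * sup_norm E (poly p)"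
    using subexponential_markov[of 1] by auto
  show ?thesis
    using \<delta>(2)[of _ n] sup_norm_poly_pos
    by (intro bdd_aboveI2[of _ _ "exp (real (Suc n) * 1) / \<delta>"]) (simp add: pos_divide_le_eq)
qed

lemma markov_const_le:
  assumes "\<epsilon> > 0"
  shows "\<exists>\<delta>>0. \<forall>n. markov_const E n \<le> exp (real (Suc n) * \<epsilon>) / \<delta>"
proof -
  obtain \<delta> where \<delta>: "\<delta> > 0" "\<And>n p. degree p \<le> n \<Longrightarrow>
      sup_norm E (poly (pderiv p)) \<le> exp (real (Suc n) * \<epsilon>) / \<delta> * sup_norm E (poly p)"
    using subexponential_markov[OF assms] by blast
  have "markov_const E n \<le> exp (real (Suc n) * \<epsilon>) / \<delta>" for n
    unfolding markov_const_def
  proof (rule cSUP_least)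
    have "[:1:] \<in> {p :: complex poly. p \<noteq> 0 \<and> degree p \<le> n}"
      by simp
    then show "{p :: complex poly. p \<noteq> 0 \<and> degree p \<le> n} \<noteq> {}"
      by blast
  next
    fix p :: "complex poly" assume "p \<in> {p. p \<noteq> 0 \<and> degree p \<le> n}"
    then show "sup_norm E (poly (pderiv p)) / sup_norm E (poly p) \<le> exp (real (Suc n) * \<epsilon>) / \<delta>"
      using \<delta>(2)[of p n] sup_norm_poly_pos[of p] by (simp add: pos_divide_le_eq)
  qed
  then show ?thesis
    using \<delta>(1) by blast
qed

lemma sup_norm_pderiv_le:
  assumes "degree p \<le> n"
  shows "sup_norm E (poly (pderiv p)) \<le> markov_const E n * sup_norm E (poly p)"
proof (cases "p = 0")
  case True
  then show ?thesis
    using nonempty by (simp add: sup_norm_def)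
next
  case False
  then have "sup_norm E (poly (pderiv p)) / sup_norm E (poly p) \<le> markov_const E n"
    unfolding markov_const_def using assms
    by (intro cSUP_upper[OF _ bdd_above_markov_quotients]) simp
  then show ?thesis
    using sup_norm_poly_pos[OF False] by (simp add: pos_divide_le_eq)
qed

lemma markov_const_pos:
  assumes "n \<ge> 1"
  shows "0 < markov_const E n"
proof -
  have "0 < sup_norm E (poly (pderiv [:0, 1:]))"
    by (rule sup_norm_poly_pos) (simp add: pderiv_pCons)
  also have "\<dots> \<le> markov_const E n * sup_norm E (poly [:0, 1:])"
    using assms by (intro sup_norm_pderiv_le) simp
  finally show ?thesis
    using sup_norm_poly_pos[of "[:0, 1:]"] by (simp add: zero_less_mult_iff)
qed

lemma sup_norm_higher_pderiv_le:
  assumes "degree p \<le> n" "n \<ge> 1"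
  shows "sup_norm E (poly ((pderiv ^^ k) p)) \<le> markov_const E n ^ k * sup_norm E (poly p)"
proof (induction k)
  case (Suc k)
  have "degree ((pderiv ^^ k) p) \<le> degree p"
    by (induction k) (auto simp: degree_pderiv)
  then have "sup_norm E (poly ((pderiv ^^ Suc k) p)) \<le>
      markov_const E n * sup_norm E (poly ((pderiv ^^ k) p))"
    using sup_norm_pderiv_le[of "(pderiv ^^ k) p" n] assms(1) by simp
  also have "\<dots> \<le> markov_const E n * (markov_const E n ^ k * sup_norm E (poly p))"
    using Suc markov_const_pos[OF assms(2)] by (intro mult_left_mono) auto
  finally show ?case
    by (simp add: mult.assoc)
qed simp

text \<open>The Taylor expansion of \<open>p\<close> at \<open>w\<close> is majorised term by term by an exponential series,
  because the \<open>k\<close>-th derivative costs at most the \<open>k\<close>-th power of the Markov constant.\<close>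

lemma poly_increment_le:
  assumes "degree p \<le> n" "n \<ge> 1" "w \<in> E"
  shows "cmod (poly p z - poly p w) \<le>
    sup_norm E (poly p) * (exp (markov_const E n * cmod (z - w)) - 1)"
proof -
  define m where "m = sup_norm E (poly p)"
  define M where "M = markov_const E n"
  define r where "r = cmod (z - w)"
  define f where "f k = (deriv ^^ k) (poly p) w / fact k * (z - w) ^ k" for k
  have "poly p holomorphic_on ball w (r + 1)" "z \<in> ball w (r + 1)"
    by (auto intro!: holomorphic_intros simp: r_def dist_norm norm_minus_commute)
  then have "f sums poly p z"
    unfolding f_def by (rule holomorphic_power_series)
  then have 1: "(\<lambda>k. f (Suc k)) sums (poly p z - poly p w)"
    by (subst sums_Suc_iff) (simp add: f_def)
  have "(\<lambda>k. m * ((M * r) ^ k /\<^sub>R fact k)) sums (m * exp (M * r))"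
    by (intro sums_mult exp_converges)
  then have 2: "(\<lambda>k. m * ((M * r) ^ Suc k /\<^sub>R fact (Suc k))) sums (m * (exp (M * r) - 1))"
    by (subst sums_Suc_iff) (simp add: algebra_simps)
  have le: "cmod (f k) \<le> m * ((M * r) ^ k /\<^sub>R fact k)" for k
  proof -
    have "cmod ((deriv ^^ k) (poly p) w) \<le> M ^ k * m"
      using cmod_poly_le_sup_norm[OF compact assms(3)] sup_norm_higher_pderiv_le[OF assms(1,2), of k]
      unfolding higher_deriv_poly M_def m_def by (rule order_trans)
    then have "cmod ((deriv ^^ k) (poly p) w) / fact k * r ^ k \<le> M ^ k * m / fact k * r ^ k"
      by (intro mult_right_mono divide_right_mono) (auto simp: r_def)
    then show ?thesis
      by (simp add: f_def r_def norm_mult norm_divide norm_power field_simps power_mult_distrib)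
  qed
  show ?thesis
    using norm_sums_le[OF 1 2] le unfolding m_def M_def r_def by blast
qed

end

section \<open>Gaps of pseudo Leja sequences\<close>

lemma node_poly_eq_poly: "node_poly a n = poly (\<Prod>j<n. [:- a j, 1:])"
  by (simp add: fun_eq_iff node_poly_def poly_prod)

lemma degree_node_poly: "degree (\<Prod>j<n. [:- a j, 1:] :: complex poly) = n"
  by (simp add: degree_prod_eq_sum_degree)

lemma half_le_ln_one_plus:
  fixes x :: real
  assumes "0 \<le> x" "x \<le> 1"
  shows "x / 2 \<le> ln (1 + x)"
proof -
  have "x / 2 \<le> x / (1 + x)"
    using assms by (intro divide_left_mono) auto
  also have "\<dots> = 1 - 1 / (1 + x)"
    using assms by (simp add: field_simps)
  also have "\<dots> \<le> - ln (1 / (1 + x))"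
    using ln_le_minus_one[of "1 / (1 + x)"] assms by simp
  also have "\<dots> = ln (1 + x)"
    using assms by (simp add: ln_div)
  finally show ?thesis .
qed

locale green_pseudo_leja = green_function +
  fixes C :: "nat \<Rightarrow> real" and a :: "nat \<Rightarrow> complex"
  assumes leja: "pseudo_leja E C a"
begin

lemma a_mem: "a n \<in> E"
  using leja by (simp add: pseudo_leja_def)

lemma node_poly_pos: "0 < sup_norm E (node_poly a n)"
  unfolding node_poly_eq_poly by (intro sup_norm_poly_pos) (simp add: prod_zero_iff)

lemma C_ge_1:
  assumes "n \<ge> 1"
  shows "1 \<le> C n"
proof -
  have *: "sup_norm E (node_poly a n) \<le> C n * cmod (node_poly a n (a n))"
    using leja assms by (simp add: pseudo_leja_def)
  have "0 < C n"
    using * node_poly_pos[of n] by (smt (verit) mult_nonpos_nonneg norm_ge_zero)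
  have "cmod (node_poly a n (a n)) \<le> sup_norm E (node_poly a n)"
    unfolding node_poly_eq_poly by (rule cmod_poly_le_sup_norm[OF compact a_mem])
  then have "C n * cmod (node_poly a n (a n)) \<le> C n * sup_norm E (node_poly a n)"
    using \<open>0 < C n\<close> by (intro mult_left_mono) auto
  with * have "1 * sup_norm E (node_poly a n) \<le> C n * sup_norm E (node_poly a n)"
    by simp
  then show ?thesis
    using node_poly_pos[of n] by (simp only: mult_le_cancel_right_pos)
qed

text \<open>The node polynomial \<open>w\<close> vanishes at \<open>a j\<close> but is at least \<open>\<parallel>w\<parallel> / C n\<close> at \<open>a n\<close>,
  so the increment from \<open>a j\<close> to \<open>a n\<close> is large, whereas \<open>poly_increment_le\<close> bounds it by
  \<open>\<parallel>w\<parallel> (exp r - 1)\<close>.\<close>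

lemma node_distance_lower_bound:
  assumes "j < n"
  shows "ln (1 + 1 / C n) / markov_const E n \<le> cmod (a n - a j)"
proof -
  define m where "m = sup_norm E (node_poly a n)"
  define r where "r = markov_const E n * cmod (a n - a j)"
  have n: "n \<ge> 1"
    using assms by simp
  have C: "C n > 0"
    using C_ge_1[OF n] by simp
  have "node_poly a n (a j) = 0"
    using assms by (auto simp: node_poly_def prod_zero_iff)
  then have "cmod (node_poly a n (a n)) \<le> m * (exp r - 1)"
    using poly_increment_le[OF eq_refl[OF degree_node_poly] n a_mem[of j], of a "a n"]
    unfolding m_def r_def node_poly_eq_poly by simp
  then have "C n * cmod (node_poly a n (a n)) \<le> C n * (m * (exp r - 1))"
    using C by (intro mult_left_mono) auto
  moreover have "m \<le> C n * cmod (node_poly a n (a n))"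
    unfolding m_def using leja n by (simp add: pseudo_leja_def)
  ultimately have "m * 1 \<le> m * (C n * (exp r - 1))"
    by (simp add: algebra_simps)
  then have "1 \<le> C n * (exp r - 1)"
    using node_poly_pos[of n] unfolding m_def by (simp only: mult_le_cancel_left_pos)
  then have "1 + 1 / C n \<le> exp r"
    using C by (simp add: field_simps)
  then have "ln (1 + 1 / C n) \<le> r"
    using C ln_mono[of "1 + 1 / C n" "exp r"] by (simp add: add_pos_pos)
  then show ?thesis
    using markov_const_pos[OF n] by (simp add: r_def pos_divide_le_eq mult.commute)
qed

lemma min_gap_lower_bound:
  assumes "n \<ge> 1"
  shows "ln (1 + 1 / C n) / markov_const E n \<le> min_gap a n"
  unfolding min_gap_def using assms node_distance_lower_bound
  by (subst Min_ge_iff) (auto simp: lessThan_empty_iff)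

lemma log_bound_ge:
  assumes "n \<ge> 1"
  shows "1 / (2 * C n * markov_const E n) \<le> ln (1 + 1 / C n) / markov_const E n"
proof -
  have "1 / C n / 2 \<le> ln (1 + 1 / C n)"
    using C_ge_1[OF assms] by (intro half_le_ln_one_plus) auto
  then have "1 / C n / 2 / markov_const E n \<le> ln (1 + 1 / C n) / markov_const E n"
    using markov_const_pos[OF assms] by (intro divide_right_mono) auto
  then show ?thesis
    by (simp add: mult_ac)
qed

lemma min_gap_bounded: "\<exists>R>0. \<forall>n\<ge>1. min_gap a n \<le> R"
proof -
  obtain R where R: "\<And>z. z \<in> E \<Longrightarrow> cmod z \<le> R"
    using compact_imp_bounded[OF compact] unfolding bounded_iff by blast
  have "min_gap a n \<le> 2 * \<bar>R\<bar> + 1" if "n \<ge> 1" for n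
  proof -
    have "min_gap a n \<le> cmod (a n - a 0)"
      unfolding min_gap_def using that by (intro Min_le) auto
    also have "\<dots> \<le> cmod (a n) + cmod (a 0)"
      by (rule norm_triangle_ineq4)
    also have "\<dots> \<le> 2 * \<bar>R\<bar> + 1"
      using R[OF a_mem[of n]] R[OF a_mem[of 0]] by linarith
    finally show ?thesis .
  qed
  then show ?thesis
    by (intro exI[of _ "2 * \<bar>R\<bar> + 1"]) (simp add: add_nonneg_pos)
qed

text \<open>The lower bound \<open>1 / (2 C\<^sub>n M\<^sub>n)\<close> with \<open>M\<^sub>n \<le> exp ((n + 1) \<epsilon>) / \<delta>\<close> has \<open>n\<close>-th
  root tending to \<open>exp (- \<epsilon>)\<close>, and \<open>\<epsilon>\<close> is chosen so that this exceeds \<open>y\<close>.\<close>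

lemma min_gap_root_eventually_gt:
  assumes "y < 1"
  shows "\<forall>\<^sub>F n in sequentially. y < root n (min_gap a n)"
proof -
  obtain x where x: "y < x" "0 < x" "x < 1"
    using dense[of "max y 0" 1] assms by auto
  define \<epsilon> where "\<epsilon> = - ln x"
  have \<epsilon>: "\<epsilon> > 0" "exp (- \<epsilon>) = x"
    using x by (auto simp: \<epsilon>_def)
  obtain \<delta> where \<delta>: "\<delta> > 0" "\<And>n. markov_const E n \<le> exp (real (Suc n) * \<epsilon>) / \<delta>"
    using markov_const_le[OF \<epsilon>(1)] by blast
  have "(\<lambda>n. root n (x * \<delta> / 2) / root n (C n) * x) \<longlonglongrightarrow> 1 / 1 * x"
    using leja x \<delta>(1) unfolding pseudo_leja_def
    by (intro tendsto_intros LIMSEQ_root_const) auto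
  then have "\<forall>\<^sub>F n in sequentially. y < root n (x * \<delta> / 2) / root n (C n) * x"
    by (rule order_tendstoD) (use x in simp)
  then show ?thesis
    using eventually_ge_at_top[of 1]
  proof eventually_elim
    case (elim n)
    have C: "C n > 0"
      using C_ge_1[OF elim(2)] by simp
    have M: "markov_const E n > 0"
      using markov_const_pos[OF elim(2)] .
    have "exp (real (Suc n) * \<epsilon>) = 1 / x ^ Suc n"
      unfolding exp_of_nat_mult \<epsilon>(2)[symmetric] by (simp add: exp_minus field_simps)
    then have "1 / (2 * C n * (1 / x ^ Suc n / \<delta>)) \<le> 1 / (2 * C n * markov_const E n)"
      using \<delta>(2)[of n] \<delta>(1) C M x by (intro divide_left_mono mult_left_mono mult_pos_pos) auto
    also have "\<dots> \<le> min_gap a n"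
      using log_bound_ge[OF elim(2)] min_gap_lower_bound[OF elim(2)] by simp
    finally have "root n (1 / (2 * C n * (1 / x ^ Suc n / \<delta>))) \<le> root n (min_gap a n)"
      using elim(2) by (intro real_root_le_mono) auto
    also have "1 / (2 * C n * (1 / x ^ Suc n / \<delta>)) = x * \<delta> / 2 / C n * x ^ n"
      using x \<delta>(1) by (simp add: field_simps)
    also have "root n \<dots> = root n (x * \<delta> / 2) / root n (C n) * x"
      using elim(2) x by (simp add: real_root_mult real_root_divide real_root_power_cancel)
    finally show ?case
      using elim(1) by simp
  qed
qed

lemma min_gap_root_tendsto_1: "(\<lambda>n. root n (min_gap a n)) \<longlonglongrightarrow> 1"
proof (rule order_tendstoI)
  fix y :: real assume "y < 1"
  then show "\<forall>\<^sub>F n in sequentially. y < root n (min_gap a n)"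
    by (rule min_gap_root_eventually_gt)
next
  fix y :: real assume y: "1 < y"
  obtain R where R: "R > 0" "\<And>n. n \<ge> 1 \<Longrightarrow> min_gap a n \<le> R"
    using min_gap_bounded by blast
  have "\<forall>\<^sub>F n in sequentially. root n R < y"
    using LIMSEQ_root_const[OF R(1)] y by (rule order_tendstoD)
  then show "\<forall>\<^sub>F n in sequentially. root n (min_gap a n) < y"
    using eventually_ge_at_top[of 1]
  proof eventually_elim
    case (elim n)
    then have "root n (min_gap a n) \<le> root n R"
      using R(2)[of n] by (intro real_root_le_mono) auto
    with elim(1) show ?case
      by simp
  qed
qed

end

theorem theorem3p11:
  fixes E :: "complex set" and a :: "nat \<Rightarrow> complex" and C :: "nat \<Rightarrow> real"
  assumes "compact E" and "regular_set E" and "pseudo_leja E C a"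
  shows "(\<lambda>n. root n (min_gap a n)) \<longlonglongrightarrow> 1 \<and>
    (\<forall>n\<ge>1. min_gap a n \<ge> ln (1 + 1 / C n) / markov_const E n \<and>
           ln (1 + 1 / C n) / markov_const E n \<ge> 1 / (2 * C n * markov_const E n))"
proof -
  obtain g where "is_green_function E g"
    using assms(2) unfolding regular_set_def by blast
  then interpret green_pseudo_leja E g C a
    using assms by unfold_locales (auto simp: pseudo_leja_def)
  show ?thesis
    using min_gap_root_tendsto_1 min_gap_lower_bound log_bound_ge by blast
qed

end
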